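(* Let $G$ be a finite group, let $X,Y$ be finite transitive $G$-sets, let $n\ge1$, and let $(P,Q):\widetilde G\to \mathrm{Mon}(X,\mu_n)\times \mathrm{Mon}(Y,\mu_n)$ be a monomial cover of $(G,X,Y)$. Let $O_1,\dots,O_r$ be the set of all orientable $G$-orbits in $X\times Y$ with respect to the $(P,Q)$-action. (a) $\mathcal A_{P,Q}(X,Y)$ has a basis $\{B_i\}_{1\le i\le r}$ of matrices with entries in $\mu_n^+$ such that $\mathrm{supp}(B_i)=O_i$ for $1\le i\le r$. In particular the dimension over $\mathbb C$ of $\mathcal A_{P,Q}(X,Y)$ equals the number of orientable orbits. (b) Suppose that $|X|=|Y|$ and that $\mathcal A_{P,Q}(X,Y)$ contains an invertible matrix. Then $$\dim_{\mathbb C}\mathcal A_{P,Q}(X,Y)=\dim_{\mathbb C}\mathcal A_P(X).$$ In particular the $(P,Q)$-action and the $(P,P)$-action have the same number of orientable orbits. (c) If the $(P,P)$-action has a single orientable orbit, then every matrix $A\in\mathcal A_{P,Q}(X,Y)$ is orthogonal, i.e. satisfies $AA^*=cI$ for some scalar $c$.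
   Context: $\mu_n\subset\mathbb C^\times$ is the group of $n$-th roots of unity, $\tau=\exp(2\pi i/n)$, $\mu_n^+=\{0\}\cup\mu_n$. $\mathrm{Mon}(S,\mu_n)$ is the group of monomial matrices indexed by a finite set $S$ with nonzero entries in $\mu_n$. $p_X(g),p_Y(g)$ are the permutation matrices of $g\in G$ acting on $X,Y$; $|\cdot|$ is entrywise absolute value and $*$ is conjugate-transpose. A monomial cover of $(G,X,Y)$ is a finite group $\widetilde G$ with a surjective homomorphism $\rho:\widetilde G\to G$ and a homomorphism $(P,Q):\widetilde G\to \mathrm{Mon}(X,\mu_n)\times \mathrm{Mon}(Y,\mu_n)$ such that $|P(g)|=p_X(\rho(g))$, $|Q(g)|=p_Y(\rho(g))$ for all $g$, and $\ker\rho$ is mapped into the subgroup $\mathrm{Triv}=\langle(\tau I,\tau I)\rangle$. $\widetilde G$ acts on $X$ and $Y$ through $\rho$. The $(P,Q)$-action of $\widetilde G$ on complex $X\times Y$ matrices is $g:A\mapsto P(g)AQ(g)^*$; $\mathcal A_{P,Q}(X,Y)\subseteq\mathbb C^{X\times Y}$ is the complex vector space of matrices invariant under it, and $\mathcal A_P(X):=\mathcal A_{P,P}(X,X)\subseteq\mathbb C^{X\times X}$. The support of $A$ is $\mathrm{supp}(A)=\{(x,y):A_{x,y}\neq0\}$. For a monomial matrix $M$, $\mathrm{sign}(s,M)$ is the unique nonzero entry of $M$ in row $s$. A pair $(x,y)\in X\times Y$ is orientable with respect to the $(P,Q)$-action if $\mathrm{sign}(x,P(g))=\mathrm{sign}(y,Q(g))$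 for all $g\in\widetilde G$ with $gx=x$, $gy=y$. Orientability depends only on the $G$-orbit of $(x,y)$; an orbit is orientable if its points are. For the $(P,P)$-action the same definitions apply with $Y=X$, $Q=P$, to $G$-orbits in $X\times X$. *)

theory Defs
  imports
    "HOL-Analysis.Analysis"
    "HOL-Algebra.Group_Action"
    "HOL-Algebra.Generated_Groups"
begin

section \<open>Complex matrices indexed by finite types\<close>

text \<open>A complex \<open>X \<times> Y\<close> matrix is an element of \<open>complex^'y^'x\<close>: rows are indexed by \<open>'x\<close>,
  columns by \<open>'y\<close>.\<close>

definition ctranspose :: "complex^'y^'x \<Rightarrow> complex^'x^'y" where
  "ctranspose A = (\<chi> j i. cnj (A $ i $ j))"

definition abs_mat :: "complex^'y^'x \<Rightarrow> complex^'y^'x" where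
  "abs_mat A = (\<chi> i j. of_real (cmod (A $ i $ j)))"

definition supp :: "complex^'y^'x \<Rightarrow> ('x \<times> 'y) set" where
  "supp A = {(x, y). A $ x $ y \<noteq> 0}"

text \<open>The library's scalings of \<open>complex^'y^'x\<close> are by reals or by elements of \<open>complex^'y\<close>;
  scaling by complex numbers has to be introduced.\<close>

definition cscale :: "complex \<Rightarrow> complex^'y^'x \<Rightarrow> complex^'y^'x" where
  "cscale c A = (\<chi> i j. c * A $ i $ j)"

interpretation cmat: vector_space cscale
  by unfold_locales (simp_all add: cscale_def vec_eq_iff algebra_simps)


section \<open>Monomial matrices\<close>

definition mu :: "nat \<Rightarrow> complex set" where
  "mu n = {z. z ^ n = 1}"

definition mu_plus :: "nat \<Rightarrow> complex set" where
  "mu_plus n = insert 0 (mu n)"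

definition tau :: "nat \<Rightarrow> complex" where
  "tau n = exp (2 * of_real pi * \<i> / of_nat n)"

definition monomial_mat :: "complex^'s^'s \<Rightarrow> bool" where
  "monomial_mat M \<longleftrightarrow> (\<forall>s. \<exists>!t. M $ s $ t \<noteq> 0) \<and> (\<forall>t. \<exists>!s. M $ s $ t \<noteq> 0)"

definition Mon :: "nat \<Rightarrow> (complex^'s^'s) monoid" where
  "Mon n = \<lparr>carrier = {M. monomial_mat M \<and> (\<forall>s t. M $ s $ t \<noteq> 0 \<longrightarrow> M $ s $ t \<in> mu n)},
            monoid.mult = (**), one = mat 1\<rparr>"

definition sign_at :: "'s \<Rightarrow> complex^'s^'s \<Rightarrow> complex" where
  "sign_at s M = M $ s $ (THE t. M $ s $ t \<noteq> 0)"

text \<open>The permutation matrix of \<open>f\<close> sends the basis column vector \<open>e\<^sub>s\<close> to \<open>e\<^bsub>f s\<^esub>\<close>, so that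
  permutation matrices depend multiplicatively on \<open>f\<close>.\<close>

definition perm_mat :: "('s \<Rightarrow> 's) \<Rightarrow> complex^'s^'s" where
  "perm_mat f = (\<chi> s t. if s = f t then 1 else 0)"


section \<open>Monomial covers\<close>

text \<open>Here \<open>\<phi>\<close> and \<open>\<psi>\<close> are the actions of \<open>G\<close> on the index sets \<open>X = UNIV :: 'x set\<close> and
  \<open>Y = UNIV :: 'y set\<close>, and \<open>\<rho>\<close> maps the covering group \<open>Gt\<close> onto \<open>G\<close>.\<close>

definition Triv :: "nat \<Rightarrow> ((complex^'x^'x) \<times> (complex^'y^'y)) set" where
  "Triv n = generate (Mon n \<times>\<times> Mon n) {(mat (tau n), mat (tau n))}"

definition monomial_cover ::
  "nat \<Rightarrow> ('g, 'm) monoid_scheme \<Rightarrow> ('g \<Rightarrow> 'x::finite \<Rightarrow> 'x) \<Rightarrow> ('g \<Rightarrow> 'y::finite \<Rightarrow> 'y) \<Rightarrow>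
   ('h, 'k) monoid_scheme \<Rightarrow> ('h \<Rightarrow> 'g) \<Rightarrow> ('h \<Rightarrow> complex^'x^'x) \<Rightarrow> ('h \<Rightarrow> complex^'y^'y) \<Rightarrow> bool"
  where
  "monomial_cover n G \<phi> \<psi> Gt \<rho> P Q \<longleftrightarrow>
     group Gt \<and> finite (carrier Gt) \<and> \<rho> \<in> epi Gt G \<and>
     (\<lambda>g. (P g, Q g)) \<in> hom Gt (Mon n \<times>\<times> Mon n) \<and>
     (\<forall>g\<in>carrier Gt. abs_mat (P g) = perm_mat (\<phi> (\<rho> g))) \<and>
     (\<forall>g\<in>carrier Gt. abs_mat (Q g) = perm_mat (\<psi> (\<rho> g))) \<and>
     (\<lambda>g. (P g, Q g)) ` kernel Gt G \<rho> \<subseteq> Triv n"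

definition invariant_mats ::
  "('h, 'k) monoid_scheme \<Rightarrow> ('h \<Rightarrow> complex^'x^'x) \<Rightarrow> ('h \<Rightarrow> complex^'y^'y) \<Rightarrow> (complex^'y^'x) set"
  where
  "invariant_mats Gt P Q = {A. \<forall>g\<in>carrier Gt. P g ** A ** ctranspose (Q g) = A}"


section \<open>Orientable orbits\<close>

definition diag_action :: "('g \<Rightarrow> 'x \<Rightarrow> 'x) \<Rightarrow> ('g \<Rightarrow> 'y \<Rightarrow> 'y) \<Rightarrow> 'g \<Rightarrow> 'x \<times> 'y \<Rightarrow> 'x \<times> 'y" where
  "diag_action \<phi> \<psi> g = (\<lambda>(x, y). (\<phi> g x, \<psi> g y))"

definition orientable ::
  "('g \<Rightarrow> 'x \<Rightarrow> 'x) \<Rightarrow> ('g \<Rightarrow> 'y \<Rightarrow> 'y) \<Rightarrow> ('h, 'k) monoid_scheme \<Rightarrow> ('h \<Rightarrow> 'g) \<Rightarrow>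
   ('h \<Rightarrow> complex^'x^'x) \<Rightarrow> ('h \<Rightarrow> complex^'y^'y) \<Rightarrow> 'x \<times> 'y \<Rightarrow> bool"
  where
  "orientable \<phi> \<psi> Gt \<rho> P Q = (\<lambda>(x, y). \<forall>g\<in>carrier Gt.
     \<phi> (\<rho> g) x = x \<and> \<psi> (\<rho> g) y = y \<longrightarrow> sign_at x (P g) = sign_at y (Q g))"

definition orientable_orbits ::
  "('g, 'm) monoid_scheme \<Rightarrow> ('g \<Rightarrow> 'x \<Rightarrow> 'x) \<Rightarrow> ('g \<Rightarrow> 'y \<Rightarrow> 'y) \<Rightarrow> ('h, 'k) monoid_scheme \<Rightarrow>
   ('h \<Rightarrow> 'g) \<Rightarrow> ('h \<Rightarrow> complex^'x^'x) \<Rightarrow> ('h \<Rightarrow> complex^'y^'y) \<Rightarrow> ('x \<times> 'y) set set"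
  where
  "orientable_orbits G \<phi> \<psi> Gt \<rho> P Q =
     {C \<in> orbits G (UNIV \<times> UNIV) (diag_action \<phi> \<psi>). \<forall>p\<in>C. orientable \<phi> \<psi> Gt \<rho> P Q p}"

end

theory Submission
  imports Defs
begin

text \<open>
  Twisting by \<open>P\<close> and \<open>Q\<close> is a scalar version of permuting the positions \<open>(x, y)\<close>. The matrices
  \<open>P g\<close> are unitary, so \<open>A\<close> is invariant iff it intertwines: \<open>P g ** A = A ** Q g\<close>. Each row and
  each column of a monomial matrix has a single nonzero entry, and so the intertwining condition
  compares one pair of entries at a time: \<open>A (g z) = c g z * A z\<close> for every position \<open>z = (x, y)\<close>,
  where \<open>c g z \<in> \<mu>\<^sub>n\<close> is the nonzero entry of \<open>P g\<close> in column \<open>x\<close> times the conjugate of the nonzero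
  entry of \<open>Q g\<close> in column \<open>y\<close>. Multiplicativity of \<open>P\<close> and \<open>Q\<close> makes \<open>c\<close> a 1-cocycle.

  Such a matrix is determined on an orbit by its value at one point. A nonzero value at \<open>z\<close> forces
  \<open>c g z = 1\<close> for all \<open>g\<close> that fix \<open>z\<close>, which is exactly orientability of \<open>z\<close>; conversely, if this
  holds, the value \<open>1\<close> at \<open>z\<close> propagates consistently over the orbit, with all values in \<open>\<mu>\<^sub>n\<close>
  (\<open>untwisted_orbit_function\<close>). So the invariant matrices have exactly one degree of freedom for
  each orientable orbit, which is the first claim (\<open>orbit_basis\<close>).

  For the second claim, an invertible intertwiner \<open>A\<close> turns the intertwiners of \<open>P\<close> with itself into
  those of \<open>P\<close> with \<open>Q\<close> by \<open>M \<mapsto> M ** A\<close>, bijectively and linearly. For the third, \<open>A ** ctranspose A\<close>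
  and the identity both intertwine \<open>P\<close> with itself; if there is only one orientable orbit in
  \<open>X \<times> X\<close>, these intertwiners form a line, spanned by the identity.
\<close>


section \<open>Functions equivariant up to a cocycle\<close>

locale cocycle_action = group_action H UNIV act
  for H :: "('h, 'k) monoid_scheme" (structure) and act :: "'h \<Rightarrow> 'z \<Rightarrow> 'z" +
  fixes c :: "'h \<Rightarrow> 'z \<Rightarrow> complex"
  assumes cocycle: "g \<in> carrier H \<Longrightarrow> h \<in> carrier H \<Longrightarrow> c (g \<otimes> h) z = c g (act h z) * c h z"
    and cocycle_nonzero: "g \<in> carrier H \<Longrightarrow> c g z \<noteq> 0"
begin

sublocale H: group H
  using group_hom group_hom.axioms(1) by blast

definition equivariant :: "('z \<Rightarrow> complex) \<Rightarrow> bool" where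
  "equivariant f \<longleftrightarrow> (\<forall>g\<in>carrier H. \<forall>z. f (act g z) = c g z * f z)"

definition untwisted :: "'z \<Rightarrow> bool" where
  "untwisted z \<longleftrightarrow> (\<forall>g\<in>carrier H. act g z = z \<longrightarrow> c g z = 1)"

text \<open>If \<open>g\<close> fixes \<open>z\<close>, equivariance reads \<open>f z = c g z * f z\<close>.\<close>

lemma untwisted_if_equivariant_nonzero:
  assumes "equivariant f" and "f z \<noteq> 0"
  shows "untwisted z"
  using assms unfolding equivariant_def untwisted_def by (metis mult_cancel_right2)

lemma orbit_memI: "g \<in> carrier H \<Longrightarrow> act g z \<in> orbit H act z"
  by (auto simp: orbit_def)

lemma act_mem_orbit_iff:
  assumes "g \<in> carrier H"
  shows "act g w \<in> orbit H act z \<longleftrightarrow> w \<in> orbit H act z"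
  using orbit_trans orbit_sym orbit_memI[OF assms] by blast

lemma equivariant_nonzero_on_orbit:
  assumes "equivariant f" and "f z \<noteq> 0" and "w \<in> orbit H act z"
  shows "f w \<noteq> 0"
  using assms cocycle_nonzero by (auto simp: equivariant_def orbit_def)

lemma equivariant_proportional_on_orbit:
  assumes "equivariant b" and "equivariant f" and "b z \<noteq> 0" and "w \<in> orbit H act z"
  shows "f w = f z / b z * b w"
  using assms by (auto simp: equivariant_def orbit_def)

text \<open>Two group elements that move \<open>z\<close> to the same point differ by an element of the stabilizer,
  on which the cocycle is trivial.\<close>

lemma untwisted_cocycle_eq:
  assumes z: "untwisted z" and g: "g \<in> carrier H" and h: "h \<in> carrier H"
    and eq: "act g z = act h z"
  shows "c g z = c h z"
proof -
  let ?k = "inv h \<otimes> g"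
  have k: "?k \<in> carrier H" and ghk: "g = h \<otimes> ?k"
    using g h by (auto simp: H.inv_solve_left H.m_assoc[symmetric])
  have fixed: "act ?k z = z"
    using g h eq orbit_sym_aux[OF h] by (simp add: composition_rule)
  then have "c ?k z = 1"
    using z k by (simp add: untwisted_def)
  with fixed show ?thesis
    using cocycle[OF h k, of z] ghk by simp
qed

text \<open>An equivariant function with value \<open>1\<close> at \<open>z\<close> must take the value \<open>c g z\<close> at \<open>act g z\<close>. This is a
  consistent prescription by the previous lemma, and its equivariance is the cocycle identity.\<close>

lemma untwisted_orbit_function:
  assumes z: "untwisted z"
  obtains b where "equivariant b" and "{w. b w \<noteq> 0} = orbit H act z"
    and "\<And>w. b w \<in> insert 0 {c g z | g. g \<in> carrier H}"
proof
  \<comment> \<open>For \<open>w\<close> on the orbit, \<open>t w\<close> transports \<open>z\<close> to \<open>w\<close>.\<close>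
  define t where "t w = (SOME g. g \<in> carrier H \<and> act g z = w)" for w
  define b where "b w = (if w \<in> orbit H act z then c (t w) z else 0)" for w
  have t: "t w \<in> carrier H \<and> act (t w) z = w" if "w \<in> orbit H act z" for w
  proof -
    have "\<exists>g. g \<in> carrier H \<and> act g z = w"
      using that by (auto simp: orbit_def)
    then show ?thesis
      unfolding t_def by (rule someI_ex)
  qed
  have b: "b (act g z) = c g z" if "g \<in> carrier H" for g
    using that t[OF orbit_memI[OF that]] by (auto simp: b_def orbit_memI intro!: untwisted_cocycle_eq z)
  have "b (act g w) = c g w * b w" if g: "g \<in> carrier H" for g w
  proof (cases "w \<in> orbit H act z")
    case True
    then obtain h where h: "h \<in> carrier H" "w = act h z"
      by (auto simp: orbit_def)
    then have "b (act g w) = b (act (g \<otimes> h) z)"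
      using g by (simp add: composition_rule)
    then show ?thesis
      using g h by (simp add: b cocycle)
  next
    case False
    then show ?thesis
      using g by (simp add: b_def act_mem_orbit_iff)
  qed
  then show "equivariant b"
    by (simp add: equivariant_def)
  show "{w. b w \<noteq> 0} = orbit H act z"
    using t cocycle_nonzero by (auto simp: b_def)
  show "b w \<in> insert 0 {c g z | g. g \<in> carrier H}" for w
    using t by (auto simp: b_def)
qed

lemma untwisted_orbit_basis:
  "\<exists>B. \<forall>C\<in>{C \<in> orbits H UNIV act. \<forall>z\<in>C. untwisted z}.
     equivariant (B C) \<and> {w. B C w \<noteq> 0} = C \<and>
     (\<forall>w. B C w \<in> insert 0 {c g z | g z. g \<in> carrier H})"
proof (rule bchoice, rule ballI)
  fix C assume "C \<in> {C \<in> orbits H UNIV act. \<forall>z\<in>C. untwisted z}"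
  then obtain z where z: "C = orbit H act z" "untwisted z"
    using orbit_refl by (auto simp: orbits_def)
  obtain b where b: "equivariant b" "{w. b w \<noteq> 0} = orbit H act z"
    and "\<And>w. b w \<in> insert 0 {c g z | g. g \<in> carrier H}"
    using untwisted_orbit_function[OF z(2)] by blast
  then have "\<forall>w. b w \<in> insert 0 {c g z | g z. g \<in> carrier H}"
    by blast
  with b z(1) show "\<exists>b. equivariant b \<and> {w. b w \<noteq> 0} = C \<and>
      (\<forall>w. b w \<in> insert 0 {c g z | g z. g \<in> carrier H})"
    by blast
qed

end


section \<open>Matrices with disjoint supports\<close>

text \<open>Reading a vanishing linear combination at a position in the support of \<open>B D\<close> isolates the
  coefficient of \<open>B D\<close>. Nonempty supports also make the family injective.\<close>

lemma cmat_independent_disjoint_supp: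
  fixes B :: "'c \<Rightarrow> complex^'y::finite^'x::finite"
  assumes fin: "finite \<C>" and disj: "disjoint_family_on (\<lambda>C. supp (B C)) \<C>"
    and ne: "\<And>C. C \<in> \<C> \<Longrightarrow> supp (B C) \<noteq> {}"
  shows "inj_on B \<C>" and "cmat.independent (B ` \<C>)"
proof -
  show inj: "inj_on B \<C>"
    using disj ne unfolding inj_on_def disjoint_family_on_def by (metis inf.idem)
  show "cmat.independent (B ` \<C>)"
  proof (rule cmat.independent_if_scalars_zero)
    fix k M
    assume sum: "(\<Sum>M\<in>B ` \<C>. cscale (k M) M) = 0" and "M \<in> B ` \<C>"
    then obtain D where D: "D \<in> \<C>" "M = B D"
      by blast
    then obtain x y where xy: "(x, y) \<in> supp (B D)"
      using ne[of D] by auto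
    have "0 = (\<Sum>C\<in>\<C>. cscale (k (B C)) (B C)) $ x $ y"
      using sum by (simp add: sum.reindex[OF inj])
    also have "\<dots> = (\<Sum>C\<in>\<C>. if C = D then k (B D) * B D $ x $ y else 0)"
      unfolding sum_component cscale_def
    proof (rule sum.cong[OF refl])
      fix C assume "C \<in> \<C>"
      moreover have "B C $ x $ y = 0" if "C \<noteq> D"
        using disj xy that \<open>C \<in> \<C>\<close> D(1) by (auto simp: disjoint_family_on_def supp_def)
      ultimately show "(\<chi> i j. k (B C) * B C $ i $ j) $ x $ y =
          (if C = D then k (B D) * B D $ x $ y else 0)"
        by simp
    qed
    also have "\<dots> = k (B D) * B D $ x $ y"
      using fin D(1) by simp
    finally show "k M = 0"
      using xy D(2) by (simp add: supp_def)
  qed (use fin in simp)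
qed

text \<open>With \<open>k C\<close> the factor on the support of \<open>B C\<close>, each position receives a contribution to
  \<open>\<Sum>C\<in>\<C>. k C \<cdot> B C\<close> from at most one \<open>C\<close>, and so this sum agrees with \<open>A\<close> entry by entry.\<close>

lemma cmat_mem_span_disjoint_supp:
  fixes B :: "'c \<Rightarrow> complex^'y::finite^'x::finite"
  assumes fin: "finite \<C>" and disj: "disjoint_family_on (\<lambda>C. supp (B C)) \<C>"
    and cover: "supp A \<subseteq> (\<Union>C\<in>\<C>. supp (B C))"
    and proportional: "\<And>C. C \<in> \<C> \<Longrightarrow> \<exists>k. \<forall>(x, y)\<in>supp (B C). A $ x $ y = k * B C $ x $ y"
  shows "A \<in> cmat.span (B ` \<C>)"
proof -
  obtain k where k: "\<And>C x y. C \<in> \<C> \<Longrightarrow> (x, y) \<in> supp (B C) \<Longrightarrow> A $ x $ y = k C * B C $ x $ y"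
    using proportional by (metis (mono_tags, lifting) case_prodD)
  have "A = (\<Sum>C\<in>\<C>. cscale (k C) (B C))"
  proof (simp only: vec_eq_iff, intro allI)
    fix x y
    show "A $ x $ y = (\<Sum>C\<in>\<C>. cscale (k C) (B C)) $ x $ y"
    proof (cases "\<exists>D\<in>\<C>. (x, y) \<in> supp (B D)")
      case True
      then obtain D where D: "D \<in> \<C>" "(x, y) \<in> supp (B D)"
        by blast
      have "B C $ x $ y = 0" if "C \<in> \<C>" "C \<noteq> D" for C
        using disj D that by (auto simp: disjoint_family_on_def supp_def)
      then have "(\<Sum>C\<in>\<C>. k C * B C $ x $ y) = (\<Sum>C\<in>\<C>. if C = D then k D * B D $ x $ y else 0)"
        by (intro sum.cong) auto
      then show ?thesis
        using fin D k[OF D] by (simp add: cscale_def)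
    next
      case False
      then have "(x, y) \<notin> supp A" and "\<forall>C\<in>\<C>. B C $ x $ y = 0"
        using cover by (auto simp: supp_def)
      then show ?thesis
        by (simp add: cscale_def supp_def)
    qed
  qed
  then show ?thesis
    by (metis (no_types, lifting) cmat.span_base cmat.span_scale cmat.span_sum image_eqI)
qed


section \<open>Monomial representations over a permutation action\<close>

locale monomial_rep = group_action H UNIV act
  for H :: "('h, 'k) monoid_scheme" (structure) and act :: "'h \<Rightarrow> 's::finite \<Rightarrow> 's" +
  fixes n :: nat and M :: "'h \<Rightarrow> complex^'s^'s"
  assumes hom_Mon: "M \<in> hom H (Mon n)"
    and abs_mat_eq: "g \<in> carrier H \<Longrightarrow> abs_mat (M g) = perm_mat (act g)"
begin

lemma act_eq_iff: "g \<in> carrier H \<Longrightarrow> act g s = act g t \<longleftrightarrow> s = t"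
  using inj_prop by (auto simp: inj_on_def)

lemma entry_nonzero_iff:
  assumes "g \<in> carrier H"
  shows "M g $ s $ t \<noteq> 0 \<longleftrightarrow> s = act g t"
proof -
  have "complex_of_real (cmod (M g $ s $ t)) = (if s = act g t then 1 else 0)"
    using arg_cong[OF abs_mat_eq[OF assms], of "\<lambda>A. A $ s $ t"] by (simp add: abs_mat_def perm_mat_def)
  then show ?thesis
    by (auto split: if_splits)
qed

lemma entry_eq_0: "g \<in> carrier H \<Longrightarrow> s \<noteq> act g t \<Longrightarrow> M g $ s $ t = 0"
  using entry_nonzero_iff by blast

lemma entry_mu: "g \<in> carrier H \<Longrightarrow> M g $ act g t $ t \<in> mu n"
  using hom_Mon entry_nonzero_iff[of g "act g t" t] by (auto simp: hom_def Mon_def)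

lemma entry_cnj_mult:
  assumes "g \<in> carrier H"
  shows "cnj (M g $ act g t $ t) * M g $ act g t $ t = 1"
proof -
  have "cmod (M g $ act g t $ t) = 1"
    using arg_cong[OF abs_mat_eq[OF assms], of "\<lambda>A. A $ act g t $ t"]
    by (simp add: abs_mat_def perm_mat_def)
  then show ?thesis
    using complex_norm_square[of "M g $ act g t $ t"] by (simp add: mult.commute)
qed

lemma mult_entry:
  assumes "g \<in> carrier H"
  shows "(M g ** A) $ act g s $ t = M g $ act g s $ s * A $ s $ t"
proof -
  have "(M g ** A) $ act g s $ t = (\<Sum>u\<in>UNIV. M g $ act g s $ u * A $ u $ t)"
    by (simp add: matrix_matrix_mult_def)
  also have "\<dots> = (\<Sum>u\<in>UNIV. if u = s then M g $ act g s $ s * A $ s $ t else 0)"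
    using entry_eq_0[OF assms, of "act g s"] act_eq_iff[OF assms] by (intro sum.cong) auto
  finally show ?thesis
    by simp
qed

lemma entry_mult:
  assumes "g \<in> carrier H"
  shows "(A ** M g) $ s $ t = A $ s $ act g t * M g $ act g t $ t"
proof -
  have "(A ** M g) $ s $ t = (\<Sum>u\<in>UNIV. A $ s $ u * M g $ u $ t)"
    by (simp add: matrix_matrix_mult_def)
  also have "\<dots> = (\<Sum>u\<in>UNIV. if u = act g t then A $ s $ act g t * M g $ act g t $ t else 0)"
    using entry_eq_0[OF assms] by (intro sum.cong) auto
  finally show ?thesis
    by simp
qed

lemma unitary:
  assumes g: "g \<in> carrier H"
  shows "ctranspose (M g) ** M g = mat 1" and "M g ** ctranspose (M g) = mat 1"
proof -
  show "ctranspose (M g) ** M g = mat 1"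
    using entry_eq_0[OF g] entry_cnj_mult[OF g] act_eq_iff[OF g]
    by (auto simp: vec_eq_iff entry_mult[OF g] ctranspose_def mat_def)
  then show "M g ** ctranspose (M g) = mat 1"
    by (simp add: matrix_left_right_inverse)
qed

text \<open>In a product of monomial matrices the column of \<open>s\<close> picks up one factor on the way from \<open>s\<close> to
  \<open>act h s\<close> and one on the way from there to \<open>act g (act h s)\<close>.\<close>

lemma entry_hom:
  assumes g: "g \<in> carrier H" and h: "h \<in> carrier H"
  shows "M (g \<otimes> h) $ act (g \<otimes> h) s $ s = M g $ act g (act h s) $ act h s * M h $ act h s $ s"
proof -
  have "M (g \<otimes> h) = M g ** M h"
    using hom_mult[OF hom_Mon g h] by (simp add: Mon_def)
  then show ?thesis
    using g h by (simp add: composition_rule mult_entry)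
qed

lemma sign_at_fixed_point:
  assumes g: "g \<in> carrier H" and "act g s = s"
  shows "sign_at s (M g) = M g $ s $ s"
proof -
  have "(THE t. M g $ s $ t \<noteq> 0) = s"
  proof (rule the_equality)
    show "M g $ s $ s \<noteq> 0"
      using entry_nonzero_iff[OF g, of s s] assms(2) by simp
    show "t = s" if "M g $ s $ t \<noteq> 0" for t
      using that entry_nonzero_iff[OF g, of s t] assms(2) act_eq_iff[OF g] by metis
  qed
  then show ?thesis
    by (simp add: sign_at_def)
qed

end


section \<open>Invariant matrices\<close>

lemma ctranspose_mult: "ctranspose (A ** B) = ctranspose B ** ctranspose A"
  by (simp add: ctranspose_def matrix_matrix_mult_def vec_eq_iff mult.commute)

lemma ctranspose_ctranspose: "ctranspose (ctranspose A) = A"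
  by (simp add: ctranspose_def vec_eq_iff)

lemma mult_eq_mult_unit_iff:
  fixes a b p q q' :: "'a::comm_monoid_mult"
  assumes "q' * q = 1"
  shows "p * b = a * q \<longleftrightarrow> a = p * q' * b"
proof
  assume "p * b = a * q"
  then have "q' * (p * b) = q' * (a * q)"
    by simp
  then have "p * q' * b = a * (q' * q)"
    by (simp add: mult.assoc mult.left_commute)
  then show "a = p * q' * b"
    using assms by simp
next
  assume "a = p * q' * b"
  then have "a * q = p * b * (q' * q)"
    by (simp add: mult_ac)
  then show "p * b = a * q"
    using assms by simp
qed

locale monomial_rep_pair =
  P: monomial_rep H a n P + Q: monomial_rep H b n Q
  for H :: "('h, 'k) monoid_scheme" (structure)
    and a :: "'h \<Rightarrow> 'x::finite \<Rightarrow> 'x" and b :: "'h \<Rightarrow> 'y::finite \<Rightarrow> 'y"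
    and n :: nat and P :: "'h \<Rightarrow> complex^'x^'x" and Q :: "'h \<Rightarrow> complex^'y^'y"
begin

definition entry_cocycle :: "'h \<Rightarrow> 'x \<times> 'y \<Rightarrow> complex" where
  "entry_cocycle g = (\<lambda>(x, y). P g $ a g x $ x * cnj (Q g $ b g y $ y))"

text \<open>The cocycle identity is \<open>entry_hom\<close> for both representations.\<close>

sublocale cocycle_action H "diag_action a b" entry_cocycle
proof (intro cocycle_action.intro group_action.intro group_hom.intro group_hom_axioms.intro
    cocycle_action_axioms.intro)
  interpret group H
    using P.group_hom group_hom.axioms(1) by blast
  have "bij (diag_action a b g)" if g: "g \<in> carrier H" for g
    using P.bij_prop0[OF g] Q.bij_prop0[OF g] bij_betw_map_prod[of "a g" UNIV UNIV "b g" UNIV UNIV]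
    by (simp add: Bij_def diag_action_def map_prod_def)
  then show "diag_action a b \<in> hom H (BijGroup UNIV)"
    by (auto simp: hom_def BijGroup_def Bij_def diag_action_def compose_def fun_eq_iff
        P.composition_rule Q.composition_rule)
  show "group H" by (rule is_group)
  show "group (BijGroup (UNIV :: ('x \<times> 'y) set))" by (rule group_BijGroup)
  show "entry_cocycle (g \<otimes> h) z = entry_cocycle g (diag_action a b h z) * entry_cocycle h z"
    if "g \<in> carrier H" "h \<in> carrier H" for g h z
    using that by (cases z) (simp add: entry_cocycle_def diag_action_def P.entry_hom Q.entry_hom)
  show "entry_cocycle g z \<noteq> 0" if "g \<in> carrier H" for g z
    using that by (cases z) (simp add: entry_cocycle_def P.entry_nonzero_iff Q.entry_nonzero_iff)
qed

lemma entry_cocycle_mu: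
  assumes "g \<in> carrier H"
  shows "entry_cocycle g z \<in> mu n"
  using P.entry_mu[OF assms] Q.entry_mu[OF assms]
  by (cases z) (simp add: entry_cocycle_def mu_def power_mult_distrib flip: complex_cnj_power)

lemma invariant_iff_intertwines:
  "A \<in> invariant_mats H P Q \<longleftrightarrow> (\<forall>g\<in>carrier H. P g ** A = A ** Q g)"
proof -
  have "P g ** A ** ctranspose (Q g) = A \<longleftrightarrow> P g ** A = A ** Q g" if "g \<in> carrier H" for g
    using Q.unitary[OF that] by (metis matrix_mul_assoc matrix_mul_rid)
  then show ?thesis
    by (auto simp: invariant_mats_def)
qed

text \<open>At position \<open>(a g x, y)\<close> both sides of the intertwining identity consist of one product. Solving
  for the entry of \<open>A\<close> on the right-hand side gives equivariance.\<close>

lemma invariant_iff_equivariant: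
  "A \<in> invariant_mats H P Q \<longleftrightarrow> equivariant (\<lambda>(x, y). A $ x $ y)"
proof -
  have "P g ** A = A ** Q g \<longleftrightarrow>
      (\<forall>x y. A $ a g x $ b g y = entry_cocycle g (x, y) * A $ x $ y)" if g: "g \<in> carrier H" for g
  proof -
    have "(\<forall>x. R x) \<longleftrightarrow> (\<forall>x. R (a g x))" for R
      using P.surj_prop[OF g] by (metis surjD)
    then have "P g ** A = A ** Q g \<longleftrightarrow> (\<forall>x y. (P g ** A) $ a g x $ y = (A ** Q g) $ a g x $ y)"
      unfolding vec_eq_iff .
    then show ?thesis
      by (simp add: P.mult_entry[OF g] Q.entry_mult[OF g] entry_cocycle_def
          mult_eq_mult_unit_iff[OF Q.entry_cnj_mult[OF g]])
  qed
  then show ?thesis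
    by (simp add: invariant_iff_intertwines equivariant_def diag_action_def)
qed

text \<open>The covering group itself acts on rows and columns here, so the projection in the definition
  of orientability is the identity. Conjugation inverts a nonzero entry, so the equality of the two
  signs says that their cocycle value is \<open>1\<close>.\<close>

lemma orientable_iff_untwisted: "orientable a b H id P Q z \<longleftrightarrow> untwisted z"
proof -
  obtain x y where z: "z = (x, y)" by fastforce
  have "sign_at x (P g) = sign_at y (Q g) \<longleftrightarrow> entry_cocycle g (x, y) = 1"
    if g: "g \<in> carrier H" and fixed: "a g x = x" "b g y = y" for g
  proof -
    have "cnj (Q g $ y $ y) * Q g $ y $ y = 1"
      using Q.entry_cnj_mult[OF g, of y] fixed by simp
    then have "P g $ x $ x = Q g $ y $ y \<longleftrightarrow> P g $ x $ x * cnj (Q g $ y $ y) = 1"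
      using mult_eq_mult_unit_iff[of _ _ "P g $ x $ x" 1 1] by auto
    then show ?thesis
      using g fixed by (simp add: entry_cocycle_def P.sign_at_fixed_point Q.sign_at_fixed_point)
  qed
  then show ?thesis
    by (auto simp: z orientable_def untwisted_def diag_action_def)
qed

lemma orientable_orbits_eq:
  "orientable_orbits H a b H id P Q =
    {C \<in> orbits H UNIV (diag_action a b). \<forall>z\<in>C. untwisted z}"
  by (simp add: orientable_orbits_def orientable_iff_untwisted)

lemma subspace_invariant_mats: "cmat.subspace (invariant_mats H P Q)"
  by (auto simp: cmat.subspace_def invariant_iff_equivariant equivariant_def cscale_def
      diag_action_def algebra_simps)

text \<open>The equivariant functions supported on single untwisted orbits, read as matrices, have disjoint
  supports, hence are independent. They span because an equivariant function vanishes off the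
  untwisted orbits and is determined on each of them by one value.\<close>

lemma orbit_basis:
  "\<exists>B. inj_on B (orientable_orbits H a b H id P Q) \<and>
     cmat.independent (B ` orientable_orbits H a b H id P Q) \<and>
     cmat.span (B ` orientable_orbits H a b H id P Q) = invariant_mats H P Q \<and>
     (\<forall>C\<in>orientable_orbits H a b H id P Q.
        (\<forall>x y. B C $ x $ y \<in> mu_plus n) \<and> supp (B C) = C)"
proof -
  let ?\<C> = "orientable_orbits H a b H id P Q"
  obtain F where "\<forall>C\<in>?\<C>. equivariant (F C) \<and> {w. F C w \<noteq> 0} = C \<and>
      (\<forall>w. F C w \<in> insert 0 {entry_cocycle g z | g z. g \<in> carrier H})"
    using untwisted_orbit_basis unfolding orientable_orbits_eq by (rule exE)
  note F = bspec[OF this]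
  define B :: "('x \<times> 'y) set \<Rightarrow> complex^'y^'x" where "B C = (\<chi> x y. F C (x, y))" for C
  have B_inv: "B C \<in> invariant_mats H P Q" if "C \<in> ?\<C>" for C
    using F[OF that] by (simp add: invariant_iff_equivariant B_def)
  have supp_B: "supp (B C) = C" if "C \<in> ?\<C>" for C
    using F[OF that] by (auto simp: supp_def B_def)
  have B_mu: "B C $ x $ y \<in> mu_plus n" if "C \<in> ?\<C>" for C x y
  proof -
    have "F C (x, y) \<in> insert 0 {entry_cocycle g z | g z. g \<in> carrier H}"
      using F[OF that] by blast
    then show ?thesis
      using entry_cocycle_mu by (auto simp: B_def mu_plus_def)
  qed
  have fin: "finite ?\<C>"
    by simp
  have orbit_C: "C = orbit H (diag_action a b) z" if "C \<in> ?\<C>" "z \<in> C" for C z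
  proof -
    obtain w where w: "C = orbit H (diag_action a b) w"
      using \<open>C \<in> ?\<C>\<close> by (auto simp: orientable_orbits_eq orbits_def)
    show ?thesis
      using that(2) orbit_sym orbit_trans unfolding w by blast
  qed
  have disj: "disjoint_family_on (\<lambda>C. supp (B C)) ?\<C>"
    unfolding disjoint_family_on_def
  proof (intro ballI impI equals0I)
    fix C D z
    assume C: "C \<in> ?\<C>" and D: "D \<in> ?\<C>" and "C \<noteq> D" and "z \<in> supp (B C) \<inter> supp (B D)"
    then have "z \<in> C" and "z \<in> D"
      by (simp_all add: supp_B)
    then show False
      using orbit_C[OF C] orbit_C[OF D] \<open>C \<noteq> D\<close> by blast
  qed
  have ne: "supp (B C) \<noteq> {}" if "C \<in> ?\<C>" for C
    using that orbit_refl by (auto simp: supp_B) (auto simp: orientable_orbits_eq orbits_def)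
  have "A \<in> cmat.span (B ` ?\<C>)" if A: "A \<in> invariant_mats H P Q" for A
  proof (rule cmat_mem_span_disjoint_supp[OF fin disj])
    have eqA: "equivariant (\<lambda>(x, y). A $ x $ y)"
      using A by (simp add: invariant_iff_equivariant)
    show "supp A \<subseteq> (\<Union>C\<in>?\<C>. supp (B C))"
    proof
      fix z assume z: "z \<in> supp A"
      let ?C = "orbit H (diag_action a b) z"
      have "\<forall>w\<in>?C. untwisted w"
        using z untwisted_if_equivariant_nonzero[OF eqA] equivariant_nonzero_on_orbit[OF eqA, of z]
        by (auto simp: supp_def)
      then have "?C \<in> ?\<C>"
        unfolding orientable_orbits_eq orbits_def by blast
      then show "z \<in> (\<Union>C\<in>?\<C>. supp (B C))"
        using orbit_refl supp_B by blast
    qed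
    show "\<exists>k. \<forall>(x, y)\<in>supp (B C). A $ x $ y = k * B C $ x $ y" if C: "C \<in> ?\<C>" for C
    proof -
      obtain z where z: "z \<in> C" and C_eq: "C = orbit H (diag_action a b) z"
        using orbit_C[OF C] ne[OF C] supp_B[OF C] by blast
      have "F C z \<noteq> 0"
        using z F[OF C] by blast
      then have "(\<lambda>(x, y). A $ x $ y) w = (\<lambda>(x, y). A $ x $ y) z / F C z * F C w" if "w \<in> C" for w
        using F[OF C] eqA C_eq that by (intro equivariant_proportional_on_orbit) auto
      then have "\<forall>(x, y)\<in>C. A $ x $ y = (\<lambda>(x, y). A $ x $ y) z / F C z * B C $ x $ y"
        by (fastforce simp: B_def)
      then show ?thesis
        unfolding supp_B[OF C] ..
    qed
  qed
  then have "cmat.span (B ` ?\<C>) = invariant_mats H P Q"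
    using cmat.span_minimal[OF _ subspace_invariant_mats, of "B ` ?\<C>"] B_inv by blast
  then show ?thesis
    using cmat_independent_disjoint_supp[OF fin disj ne] supp_B B_mu
    by (intro exI[of _ B] conjI ballI allI)
qed

lemma dim_invariant_mats:
  "cmat.dim (invariant_mats H P Q) = card (orientable_orbits H a b H id P Q)"
proof -
  obtain B where "inj_on B (orientable_orbits H a b H id P Q)"
    and "cmat.independent (B ` orientable_orbits H a b H id P Q)"
    and "cmat.span (B ` orientable_orbits H a b H id P Q) = invariant_mats H P Q"
    using orbit_basis by (elim exE conjE) (rule that)
  then show ?thesis
    by (metis card_image cmat.dim_span_eq_card_independent)
qed

sublocale PP: monomial_rep_pair H a a n P P
  by unfold_locales

text \<open>Right multiplication by an invertible intertwiner is an isomorphism of spaces of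
  intertwiners, with inverse the right multiplication by the inverse matrix.\<close>

lemma dim_eq_if_invertible:
  assumes A: "A \<in> invariant_mats H P Q" and inv: "invertible A"
  shows "cmat.dim (invariant_mats H P Q) = cmat.dim (invariant_mats H P P)"
proof -
  obtain A' where A': "A ** A' = mat 1" "A' ** A = mat 1"
    using inv by (auto simp: invertible_def)
  define f where "f M = M ** A" for M :: "complex^'x^'x"
  interpret f: Vector_Spaces.linear cscale cscale f
    by unfold_locales
      (simp_all add: f_def cscale_def matrix_matrix_mult_def vec_eq_iff sum.distrib
        sum_distrib_left algebra_simps)
  have "f M ** A' = M" "f (N ** A') = N" for M N
    using A' by (simp_all add: f_def flip: matrix_mul_assoc)
  then have inj: "inj f"
    by (metis injI)
  have PA: "P g ** A = A ** Q g" if "g \<in> carrier H" for g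
    using A that by (simp add: invariant_iff_intertwines)
  have A'P: "A' ** P g = Q g ** A'" if "g \<in> carrier H" for g
    using A' PA[OF that] by (metis matrix_mul_assoc matrix_mul_lid matrix_mul_rid)
  have "f M \<in> invariant_mats H P Q" if "M \<in> invariant_mats H P P" for M
    using that PA unfolding f_def invariant_iff_intertwines PP.invariant_iff_intertwines
    by (metis matrix_mul_assoc)
  moreover have "N ** A' \<in> invariant_mats H P P" if "N \<in> invariant_mats H P Q" for N
    using that A'P unfolding invariant_iff_intertwines PP.invariant_iff_intertwines
    by (metis matrix_mul_assoc)
  ultimately have image: "f ` invariant_mats H P P = invariant_mats H P Q"
    using \<open>\<And>N. f (N ** A') = N\<close> by (auto intro!: image_eqI)
  obtain S where S: "cmat.independent S" "cmat.span S = invariant_mats H P P"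
    using PP.orbit_basis by (elim exE conjE) (rule that)
  have "cmat.dim (invariant_mats H P Q) = card (f ` S)"
    using f.independent_inj_image[OF S(1) inj] image S(2) f.span_image
    by (metis cmat.dim_span_eq_card_independent)
  also have "\<dots> = card S"
    using inj by (simp add: card_image inj_on_subset)
  also have "\<dots> = cmat.dim (invariant_mats H P P)"
    using S by (metis cmat.dim_span_eq_card_independent)
  finally show ?thesis .
qed

text \<open>Taking the conjugate transpose of an invariant matrix exchanges the roles of \<open>P\<close> and \<open>Q\<close>: \<open>A\<close>
  moves \<open>P g\<close> across as \<open>Q g\<close>, and \<open>ctranspose A\<close> moves \<open>Q g\<close> across as \<open>P g\<close>.\<close>

lemma mult_ctranspose_invariant:
  assumes "A \<in> invariant_mats H P Q"
  shows "A ** ctranspose A \<in> invariant_mats H P P"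
proof -
  have "P g ** (A ** ctranspose A) = (A ** ctranspose A) ** P g" if g: "g \<in> carrier H" for g
  proof -
    have A: "P g ** A ** ctranspose (Q g) = A"
      using assms g by (simp add: invariant_mats_def)
    have "P g ** A = A ** Q g"
      using assms g by (simp add: invariant_iff_intertwines)
    moreover have "Q g ** ctranspose A = ctranspose A ** P g"
      using arg_cong[OF A, of ctranspose] P.unitary[OF g]
      by (metis ctranspose_ctranspose ctranspose_mult matrix_mul_assoc matrix_mul_rid)
    ultimately show ?thesis
      by (metis matrix_mul_assoc)
  qed
  then show ?thesis
    by (simp add: PP.invariant_iff_intertwines)
qed

text \<open>With one orientable orbit the intertwiners of \<open>P\<close> with itself form a line. It contains the
  identity, so it consists of the scalar matrices.\<close>

lemma orthogonal_if_single_orientable_orbit: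
  assumes single: "card (orientable_orbits H a a H id P P) = 1" and A: "A \<in> invariant_mats H P Q"
  shows "\<exists>k. A ** ctranspose A = mat k"
proof -
  obtain B where "cmat.span (B ` orientable_orbits H a a H id P P) = invariant_mats H P P"
    using PP.orbit_basis by (elim exE conjE) (rule that)
  moreover obtain C where "orientable_orbits H a a H id P P = {C}"
    using single card_1_singletonE by blast
  ultimately have line: "invariant_mats H P P = range (\<lambda>k. cscale k (B C))"
    by (simp flip: cmat.span_singleton)
  have "mat 1 \<in> invariant_mats H P P"
    by (simp add: PP.invariant_iff_intertwines)
  then obtain k where k: "mat 1 = cscale k (B C)"
    using line by blast
  obtain l where l: "A ** ctranspose A = cscale l (B C)"
    using mult_ctranspose_invariant[OF A] line by blast
  \<comment> \<open>Any diagonal position shows that \<open>mat 1\<close> is not zero.\<close>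
  have "k \<noteq> 0"
    using arg_cong[OF k, of "\<lambda>M. M $ undefined $ undefined"] by (auto simp: mat_def cscale_def)
  then have "A ** ctranspose A = cscale (l / k) (mat 1)"
    by (simp add: k l)
  also have "\<dots> = mat (l / k)"
    by (simp add: cscale_def mat_def vec_eq_iff)
  finally show ?thesis ..
qed

end


section \<open>Monomial covers\<close>

text \<open>Since \<open>\<rho>\<close> is onto, \<open>G\<close> and its cover have the same orbits, and orientability already quantifies
  over elements of the cover. So a statement about a cover reduces to one about a single group.\<close>

lemma orientable_orbits_pullback:
  assumes "\<rho> ` carrier H = carrier G"
  shows "orientable_orbits G \<phi> \<psi> H \<rho> P Q = orientable_orbits H (\<phi> \<circ> \<rho>) (\<psi> \<circ> \<rho>) H id P Q"
proof -
  have "orbit G (diag_action \<phi> \<psi>) z = orbit H (diag_action (\<phi> \<circ> \<rho>) (\<psi> \<circ> \<rho>)) z" for z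
    unfolding orbit_def assms[symmetric] by (auto simp: diag_action_def)
  then show ?thesis
    by (simp add: orientable_orbits_def orbits_def orientable_def)
qed

lemma monomial_rep_pullback:
  assumes "group_action G UNIV \<phi>" and "group H" and "\<rho> \<in> hom H G" and "M \<in> hom H (Mon n)"
    and "\<forall>g\<in>carrier H. abs_mat (M g) = perm_mat (\<phi> (\<rho> g))"
  shows "monomial_rep H (\<phi> \<circ> \<rho>) n M"
proof -
  interpret group_action G UNIV \<phi> by fact
  have "\<phi> \<circ> \<rho> \<in> hom H (BijGroup UNIV)"
    using assms(3) group_hom group_hom.homh hom_compose by blast
  then have "group_action H UNIV (\<phi> \<circ> \<rho>)"
    using assms(2) group_BijGroup by (simp add: group_action_def group_hom_def group_hom_axioms_def)
  then show ?thesis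
    using assms(4,5) by (simp add: monomial_rep_def monomial_rep_axioms_def)
qed

theorem theorem5p2:
  fixes G :: "('g, 'm) monoid_scheme" and Gt :: "('h, 'k) monoid_scheme"
    and \<phi> :: "'g \<Rightarrow> 'x::finite \<Rightarrow> 'x" and \<psi> :: "'g \<Rightarrow> 'y::finite \<Rightarrow> 'y"
    and n :: nat and \<rho> :: "'h \<Rightarrow> 'g"
    and P :: "'h \<Rightarrow> complex^'x^'x" and Q :: "'h \<Rightarrow> complex^'y^'y"
  assumes "group G" and "finite (carrier G)"
    and "transitive_action G UNIV \<phi>" and "transitive_action G UNIV \<psi>"
    and "n \<ge> 1"
    and "monomial_cover n G \<phi> \<psi> Gt \<rho> P Q"
  shows
    "((\<exists>B :: ('x \<times> 'y) set \<Rightarrow> complex^'y^'x.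
         inj_on B (orientable_orbits G \<phi> \<psi> Gt \<rho> P Q) \<and>
         cmat.independent (B ` orientable_orbits G \<phi> \<psi> Gt \<rho> P Q) \<and>
         cmat.span (B ` orientable_orbits G \<phi> \<psi> Gt \<rho> P Q) = invariant_mats Gt P Q \<and>
         (\<forall>C\<in>orientable_orbits G \<phi> \<psi> Gt \<rho> P Q.
            (\<forall>x y. B C $ x $ y \<in> mu_plus n) \<and> supp (B C) = C))
      \<and> cmat.dim (invariant_mats Gt P Q) = card (orientable_orbits G \<phi> \<psi> Gt \<rho> P Q))
    \<and>
    (CARD('x) = CARD('y) \<and> (\<exists>A\<in>invariant_mats Gt P Q. invertible A) \<longrightarrow>
       cmat.dim (invariant_mats Gt P Q) = cmat.dim (invariant_mats Gt P P) \<and>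
       card (orientable_orbits G \<phi> \<psi> Gt \<rho> P Q) = card (orientable_orbits G \<phi> \<phi> Gt \<rho> P P))
    \<and>
    (card (orientable_orbits G \<phi> \<phi> Gt \<rho> P P) = 1 \<longrightarrow>
       (\<forall>A\<in>invariant_mats Gt P Q. \<exists>c. A ** ctranspose A = mat c))"
proof -
  have epi: "\<rho> \<in> hom Gt G" "\<rho> ` carrier Gt = carrier G"
    and PQ: "P \<in> hom Gt (Mon n)" "Q \<in> hom Gt (Mon n)"
    using assms(6) by (auto simp: monomial_cover_def epi_def hom_def DirProd_def)
  interpret monomial_rep_pair Gt "\<phi> \<circ> \<rho>" "\<psi> \<circ> \<rho>" n P Q
    using assms(3,4,6) epi PQ unfolding monomial_rep_pair_def
    by (auto simp: monomial_cover_def transitive_action_def intro!: monomial_rep_pullback)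
  show ?thesis
    unfolding orientable_orbits_pullback[OF epi(2)]
  proof (intro conjI impI)
    assume "CARD('x) = CARD('y) \<and> (\<exists>A\<in>invariant_mats Gt P Q. invertible A)"
    then show dim_eq: "cmat.dim (invariant_mats Gt P Q) = cmat.dim (invariant_mats Gt P P)"
      using dim_eq_if_invertible by blast
    then show "card (orientable_orbits Gt (\<phi> \<circ> \<rho>) (\<psi> \<circ> \<rho>) Gt id P Q) =
        card (orientable_orbits Gt (\<phi> \<circ> \<rho>) (\<phi> \<circ> \<rho>) Gt id P P)"
      by (simp only: dim_invariant_mats PP.dim_invariant_mats)
  qed (use orbit_basis dim_invariant_mats orthogonal_if_single_orientable_orbit in simp_all)
qed

end
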